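(* (a) For $w\in W$ we have $\overline{\tau(w,\mathbf q)}=(-\mathbf q)^{-|w|}\tau(w,\mathbf q)$. (b) For $w,z$ in $W$ we have $\overline{R_{z,w,\mathbf q}}=(-\mathbf q)^{-|w|+|z|}R_{z,w,\mathbf q}$.
   Context: $W$ is a Weyl group with length function $w\mapsto|w|$. The Iwahori-Hecke algebra $\mathcal H$ of $W$ over $\mathbf Q(\mathbf q)$ ($\mathbf q$ an indeterminate) has $\mathbf Q(\mathbf q)$-basis $\{T_w:w\in W\}$ with $T_wT_{w'}=T_{ww'}$ if $|ww'|=|w|+|w'|$ and $(T_t-\mathbf q)(T_t+1)=0$ if $|t|=1$. For $w\in W$, $\tau(w,\mathbf q)\in\mathbf Z[\mathbf q]$ is the trace of the linear map $\mathcal H\to\mathcal H$, $h\mapsto T_wh$. The polynomials $R_{z,w,\mathbf q}\in\mathbf Z[\mathbf q]$ ($z,w\in W$) are defined by $$(-\mathbf q)^{|w|}T_{w^{-1}}^{-1}=\sum_{z\in W}(-1)^{|z|}R_{z,w,\mathbf q}T_z\quad\text{in }\mathcal H.$$ The map $\xi\mapsto\bar\xi$ is the field automorphism of $\mathbf Q(\mathbf q)$ (over $\mathbf Q$) given by $\mathbf q\mapsto\mathbf q^{-1}$. *)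

theory Defs
  imports "HOL-Analysis.Analysis" "HOL-Computational_Algebra.Polynomial_Factorial"
begin

section \<open>Root systems and Weyl groups\<close>

definition refl_along :: "'a::real_inner \<Rightarrow> 'a \<Rightarrow> 'a" where
  "refl_along \<alpha> x = x - (2 * (\<alpha> \<bullet> x) / (\<alpha> \<bullet> \<alpha>)) *\<^sub>R \<alpha>"

text \<open>Reduced crystallographic root systems. The roots are not required to span the ambient
  Euclidean space; in particular the empty root system, with trivial Weyl group, is allowed.\<close>

definition root_system :: "'a::euclidean_space set \<Rightarrow> bool" where
  "root_system \<Phi> \<longleftrightarrow>
     finite \<Phi> \<and> 0 \<notin> \<Phi> \<and>
     (\<forall>\<alpha>\<in>\<Phi>. refl_along \<alpha> ` \<Phi> = \<Phi>) \<and>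
     (\<forall>\<alpha>\<in>\<Phi>. \<forall>\<beta>\<in>\<Phi>. 2 * (\<alpha> \<bullet> \<beta>) / (\<alpha> \<bullet> \<alpha>) \<in> \<int>) \<and>
     (\<forall>\<alpha>\<in>\<Phi>. \<forall>c. c *\<^sub>R \<alpha> \<in> \<Phi> \<longrightarrow> c = 1 \<or> c = - 1)"

definition simple_roots :: "'a::euclidean_space set \<Rightarrow> 'a set \<Rightarrow> bool" where
  "simple_roots \<Phi> \<Delta> \<longleftrightarrow>
     \<Delta> \<subseteq> \<Phi> \<and> independent \<Delta> \<and>
     (\<forall>\<beta>\<in>\<Phi>. \<exists>c :: 'a \<Rightarrow> nat.
        \<beta> = (\<Sum>\<alpha>\<in>\<Delta>. real (c \<alpha>) *\<^sub>R \<alpha>) \<or> \<beta> = - (\<Sum>\<alpha>\<in>\<Delta>. real (c \<alpha>) *\<^sub>R \<alpha>))"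

text \<open>The group generated by all reflections in roots, with composition as product. Reflections
  are involutions, so closure under left multiplication by them already gives a group.\<close>

inductive_set weyl_group :: "'a::euclidean_space set \<Rightarrow> ('a \<Rightarrow> 'a) set"
  for \<Phi> :: "'a set" where
  weyl_id: "id \<in> weyl_group \<Phi>"
| weyl_refl: "\<alpha> \<in> \<Phi> \<Longrightarrow> w \<in> weyl_group \<Phi> \<Longrightarrow> refl_along \<alpha> \<circ> w \<in> weyl_group \<Phi>"

definition weyl_length :: "'a::euclidean_space set \<Rightarrow> ('a \<Rightarrow> 'a) \<Rightarrow> nat" where
  "weyl_length \<Delta> w =
     (LEAST n. \<exists>as. set as \<subseteq> \<Delta> \<and> length as = n \<and> w = foldr (\<circ>) (map refl_along as) id)"

lemma linear_refl_along: "linear (refl_along (v::'a::euclidean_space))"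
  by (auto simp: refl_along_def linear_iff inner_add_left inner_add_right
      algebra_simps add_divide_distrib scaleR_add_left)

lemma finite_weyl_group:
  assumes "root_system (\<Phi> :: 'a::euclidean_space set)"
  shows "finite (weyl_group \<Phi>)"
proof -
  have lin: "linear w" if "w \<in> weyl_group \<Phi>" for w
    using that
  proof induction
    case weyl_id
    show ?case by (rule linear_id)
  next
    case (weyl_refl \<alpha> w)
    then show ?case by (intro linear_compose linear_refl_along)
  qed
  have maps: "w ` \<Phi> \<subseteq> \<Phi>" if "w \<in> weyl_group \<Phi>" for w
    using that
  proof induction
    case (weyl_refl \<alpha> w)
    then show ?case using assms unfolding root_system_def image_comp[symmetric] by blast
  qed simp
  have fixes_perp: "w x = x" if "w \<in> weyl_group \<Phi>" "\<And>a. a \<in> \<Phi> \<Longrightarrow> a \<bullet> x = 0" for w x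
    using that by induction (auto simp: refl_along_def inner_commute)
  have inj: "inj_on (\<lambda>w. restrict w \<Phi>) (weyl_group \<Phi>)"
  proof (rule inj_onI, rule ext)
    fix w w' x assume w: "w \<in> weyl_group \<Phi>" and w': "w' \<in> weyl_group \<Phi>"
      and eq: "restrict w \<Phi> = restrict w' \<Phi>"
    have eq\<Phi>: "w a = w' a" if "a \<in> \<Phi>" for a using fun_cong[OF eq, of a] that by simp
    obtain y z where y: "y \<in> span \<Phi>" and z: "\<And>v. v \<in> span \<Phi> \<Longrightarrow> orthogonal z v"
      and x: "x = y + z"
      using orthogonal_subspace_decomp_exists[of \<Phi> x] by blast
    have "w y = w' y"
      using linear_eq_on[OF lin[OF w] lin[OF w'] y] eq\<Phi> by blast
    moreover have "w z = z" "w' z = z"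
      using fixes_perp[OF w, of z] fixes_perp[OF w', of z] z span_base
      by (metis orthogonal_def inner_commute)+
    ultimately show "w x = w' x"
      unfolding x linear_add[OF lin[OF w]] linear_add[OF lin[OF w']] by simp
  qed
  have "(\<lambda>w. restrict w \<Phi>) ` weyl_group \<Phi> \<subseteq> PiE \<Phi> (\<lambda>_. \<Phi>)"
    using maps by (fastforce simp: PiE_def)
  moreover have "finite (PiE \<Phi> (\<lambda>_. \<Phi>))"
    using assms by (intro finite_PiE) (auto simp: root_system_def)
  ultimately show ?thesis
    using inj finite_imageD finite_subset by blast
qed

section \<open>The field of rational functions in one indeterminate and its bar involution\<close>

type_synonym ratfun = "rat poly fract"

definition qq :: ratfun where
  "qq = to_fract [:0, 1:]"

definition eval_inv_q :: "rat poly \<Rightarrow> ratfun" where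
  "eval_inv_q p = poly (map_poly (\<lambda>c. to_fract [:c:]) p) (inverse qq)"

lemma qq_nonzero [simp]: "qq \<noteq> 0"
  by (simp add: qq_def)

lemma to_fract_const_0 [simp]: "to_fract [:0::rat:] = 0"
  by simp

lemma eval_inv_q_0 [simp]: "eval_inv_q 0 = 0"
  by (simp add: eval_inv_q_def)

lemma eval_inv_q_pCons: "eval_inv_q (pCons c p) = to_fract [:c:] + inverse qq * eval_inv_q p"
  by (simp add: eval_inv_q_def map_poly_pCons)

lemma eval_inv_q_add: "eval_inv_q (p + r) = eval_inv_q p + eval_inv_q r"
proof (induction p r rule: poly_induct2)
  case (pCons a p b q)
  have "to_fract [:a + b:] = to_fract [:a:] + to_fract [:b:]"
    by (simp flip: to_fract_add)
  with pCons show ?case by (simp add: eval_inv_q_pCons algebra_simps)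
qed simp

lemma eval_inv_q_smult: "eval_inv_q (smult c p) = to_fract [:c:] * eval_inv_q p"
proof (induction p)
  case (pCons a p)
  have "to_fract [:c * a:] = to_fract [:c:] * to_fract [:a:]"
    by (simp flip: to_fract_mult)
  with pCons show ?case by (simp add: eval_inv_q_pCons algebra_simps)
qed simp

lemma eval_inv_q_mult: "eval_inv_q (p * r) = eval_inv_q p * eval_inv_q r"
  by (induction p) (simp_all add: eval_inv_q_pCons eval_inv_q_add eval_inv_q_smult algebra_simps)

lemma eval_inv_q_1 [simp]: "eval_inv_q 1 = 1"
proof -
  have "to_fract [:1::rat:] = 1" by (metis one_pCons to_fract_1)
  then show ?thesis
    unfolding one_pCons eval_inv_q_pCons by simp
qed

lemma eval_inv_q_conv_reflect:
  "to_fract (reflect_poly p) = qq ^ degree p * eval_inv_q p"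
proof -
  define h where "h = (\<lambda>c::rat. to_fract [:c:])"
  have h0: "h c = 0 \<longleftrightarrow> c = 0" for c by (simp add: h_def)
  have q: "poly (map_poly h s) qq = to_fract s" for s
  proof (induction s)
    case (pCons a s)
    have "to_fract (pCons a s) = to_fract ([:a:] + [:0, 1:] * s)" by simp
    also have "\<dots> = h a + qq * to_fract s"
      unfolding to_fract_add to_fract_mult h_def qq_def by simp
    finally show ?case using pCons by (simp add: map_poly_pCons h0)
  qed simp
  have deg: "degree (map_poly h p) = degree p"
    by (rule degree_map_poly) (simp add: h0)
  have refl: "reflect_poly (map_poly h p) = map_poly h (reflect_poly p)"
    by (rule poly_eqI) (simp add: coeff_reflect_poly coeff_map_poly deg h0)
  have "to_fract (reflect_poly p) = poly (reflect_poly (map_poly h p)) qq"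
    by (simp add: refl q)
  also have "\<dots> = qq ^ degree p * eval_inv_q p"
    unfolding poly_reflect_poly_nz[OF qq_nonzero] deg by (simp add: eval_inv_q_def h_def)
  finally show ?thesis .
qed

lemma eval_inv_q_eq_0_iff [simp]: "eval_inv_q p = 0 \<longleftrightarrow> p = 0"
proof
  assume "eval_inv_q p = 0"
  then have "to_fract (reflect_poly p) = 0"
    using eval_inv_q_conv_reflect[of p] by auto
  then show "p = 0" by simp
qed simp

definition bar :: "ratfun \<Rightarrow> ratfun" where
  "bar x = (THE y. \<exists>a b. b \<noteq> 0 \<and> x = Fract a b \<and> y = eval_inv_q a / eval_inv_q b)"

lemma bar_Fract:
  assumes "b \<noteq> 0"
  shows "bar (Fract a b) = eval_inv_q a / eval_inv_q b"
  unfolding bar_def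
proof (rule the_equality)
  fix y assume "\<exists>c d. d \<noteq> 0 \<and> Fract a b = Fract c d \<and> y = eval_inv_q c / eval_inv_q d"
  then obtain c d where "d \<noteq> 0" "a * d = c * b" "y = eval_inv_q c / eval_inv_q d"
    using assms by (auto simp: eq_fract)
  then show "y = eval_inv_q a / eval_inv_q b"
    using assms by (simp add: frac_eq_eq flip: eval_inv_q_mult)
qed (use assms in blast)

lemma bar_to_fract: "bar (to_fract p) = eval_inv_q p"
  by (simp add: to_fract_def bar_Fract)

lemma bar_0 [simp]: "bar 0 = 0" and bar_1 [simp]: "bar 1 = 1"
  using bar_to_fract[of 0] bar_to_fract[of 1] by simp_all

lemma bar_add: "bar (x + y) = bar x + bar y"
proof (cases x; cases y)
  fix a b c d assume "x = Fract a b" "b \<noteq> 0" "y = Fract c d" "d \<noteq> 0"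
  then show ?thesis
    by (simp add: bar_Fract eval_inv_q_add eval_inv_q_mult add_frac_eq)
qed

lemma bar_mult: "bar (x * y) = bar x * bar y"
proof (cases x; cases y)
  fix a b c d assume "x = Fract a b" "b \<noteq> 0" "y = Fract c d" "d \<noteq> 0"
  then show ?thesis
    by (simp add: bar_Fract eval_inv_q_mult)
qed

lemma bar_const: "bar (to_fract [:c:]) = to_fract [:c:]"
  by (simp add: bar_to_fract eval_inv_q_pCons)

lemma bar_qq: "bar qq = inverse qq"
  unfolding qq_def bar_to_fract by (simp add: eval_inv_q_pCons qq_def flip: one_pCons)

lemma bar_inverse: "bar (inverse x) = inverse (bar x)"
proof (cases "x = 0")
  case False
  then have "bar x * bar (inverse x) = 1" by (simp flip: bar_mult)
  then show ?thesis by (metis inverse_unique)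
qed simp

lemma bar_bar: "bar (bar x) = x"
proof -
  have ev: "bar (eval_inv_q p) = to_fract p" for p
  proof (induction p)
    case (pCons a p)
    have "to_fract (pCons a p) = to_fract ([:a:] + [:0, 1:] * p)" by simp
    also have "\<dots> = to_fract [:a:] + qq * to_fract p"
      unfolding to_fract_add to_fract_mult qq_def ..
    finally show ?case
      using pCons by (simp add: eval_inv_q_pCons bar_add bar_mult bar_const bar_inverse bar_qq)
  qed simp
  show ?thesis
  proof (cases x)
    case (Fract a b)
    then show ?thesis
      by (simp add: bar_Fract divide_inverse bar_mult bar_inverse ev)
         (simp add: Fract_conv_to_fract divide_inverse)
  qed
qed

section \<open>Iwahori-Hecke algebras\<close>

text \<open>Any algebra over the rational function field having a basis indexed by the Weyl group that
  satisfies the defining relations; these determine the algebra up to unique isomorphism.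
  Only the values of \<open>T\<close> on the Weyl group matter.\<close>

locale iwahori_hecke_algebra =
  vector_space smul for smul :: "ratfun \<Rightarrow> 'h::ring_1 \<Rightarrow> 'h" +
  fixes \<Phi> \<Delta> :: "'a::euclidean_space set" and T :: "('a \<Rightarrow> 'a) \<Rightarrow> 'h"
  assumes roots: "root_system \<Phi>" and simples: "simple_roots \<Phi> \<Delta>"
    and smul_mult_left: "smul c (x * y) = smul c x * y"
    and smul_mult_right: "smul c (x * y) = x * smul c y"
    and T_inj: "inj_on T (weyl_group \<Phi>)"
    and T_indep: "independent (T ` weyl_group \<Phi>)"
    and T_span: "span (T ` weyl_group \<Phi>) = UNIV"
    and T_mult: "\<lbrakk>w \<in> weyl_group \<Phi>; w' \<in> weyl_group \<Phi>;
        weyl_length \<Delta> (w \<circ> w') = weyl_length \<Delta> w + weyl_length \<Delta> w'\<rbrakk>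
        \<Longrightarrow> T w * T w' = T (w \<circ> w')"
    and T_quadratic: "\<lbrakk>t \<in> weyl_group \<Phi>; weyl_length \<Delta> t = 1\<rbrakk>
        \<Longrightarrow> (T t - smul qq 1) * (T t + 1) = 0"

text \<open>Trace of a linear endomorphism \<open>f\<close>, as the sum of the diagonal entries of its matrix with
  respect to a finite basis \<open>B\<close> of the whole space.\<close>

definition lin_trace ::
    "('k::field \<Rightarrow> 'v::ab_group_add \<Rightarrow> 'v) \<Rightarrow> 'v set \<Rightarrow> ('v \<Rightarrow> 'v) \<Rightarrow> 'k" where
  "lin_trace smul B f = (\<Sum>b\<in>B. module.representation smul B (f b) b)"

definition ring_inv :: "'h::ring_1 \<Rightarrow> 'h" where
  "ring_inv x = (THE y. x * y = 1 \<and> y * x = 1)"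

definition hecke_tau ::
    "(ratfun \<Rightarrow> 'h::ring_1 \<Rightarrow> 'h) \<Rightarrow> 'a::euclidean_space set \<Rightarrow> (('a \<Rightarrow> 'a) \<Rightarrow> 'h) \<Rightarrow>
     ('a \<Rightarrow> 'a) \<Rightarrow> ratfun" where
  "hecke_tau smul \<Phi> T w = lin_trace smul (T ` weyl_group \<Phi>) (\<lambda>h. T w * h)"

text \<open>\<open>(-1)^|z|\<close> times the coefficient of \<open>T z\<close> in \<open>(-q)^|w| T(w\<^sup>-\<^sup>1)\<^sup>-\<^sup>1\<close>; the usual
  defining expansion is the lemma \<open>hecke_R_expansion\<close> below.\<close>

definition hecke_R ::
    "(ratfun \<Rightarrow> 'h::ring_1 \<Rightarrow> 'h) \<Rightarrow> 'a::euclidean_space set \<Rightarrow> 'a set \<Rightarrow> (('a \<Rightarrow> 'a) \<Rightarrow> 'h) \<Rightarrow>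
     ('a \<Rightarrow> 'a) \<Rightarrow> ('a \<Rightarrow> 'a) \<Rightarrow> ratfun" where
  "hecke_R smul \<Phi> \<Delta> T z w =
     (-1) ^ weyl_length \<Delta> z *
     module.representation smul (T ` weyl_group \<Phi>)
       (smul ((- qq) ^ weyl_length \<Delta> w) (ring_inv (T (inv w)))) (T z)"

lemma (in iwahori_hecke_algebra) hecke_R_expansion:
  "smul ((- qq) ^ weyl_length \<Delta> w) (ring_inv (T (inv w))) =
     (\<Sum>z\<in>weyl_group \<Phi>. smul ((-1) ^ weyl_length \<Delta> z * hecke_R smul \<Phi> \<Delta> T z w) (T z))"
proof -
  let ?v = "smul ((- qq) ^ weyl_length \<Delta> w) (ring_inv (T (inv w)))"
  have fin: "finite (weyl_group \<Phi>)" by (rule finite_weyl_group[OF roots])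
  have "?v = (\<Sum>b\<in>T ` weyl_group \<Phi>. smul (representation (T ` weyl_group \<Phi>) ?v b) b)"
    using sum_representation_eq[OF T_indep, of ?v "T ` weyl_group \<Phi>"] T_span fin by simp
  also have "\<dots> = (\<Sum>z\<in>weyl_group \<Phi>. smul (representation (T ` weyl_group \<Phi>) ?v (T z)) (T z))"
    by (simp add: sum.reindex[OF T_inj])
  also have "\<dots> = (\<Sum>z\<in>weyl_group \<Phi>.
      smul ((-1) ^ weyl_length \<Delta> z * hecke_R smul \<Phi> \<Delta> T z w) (T z))"
    by (simp add: hecke_R_def flip: mult.assoc power_mult_distrib)
  finally show ?thesis .
qed

end

theory Submission
  imports Defs
begin

text \<open>Both identities express one symmetry of the Hecke algebra \<open>\<H>\<close>. Let \<open>\<psi>\<close> (\<open>hecke_bar\<close> below) be the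
  additive map \<open>\<H> \<rightarrow> \<H>\<close> that is semilinear with respect to \<open>bar\<close> and sends \<open>T z\<close> to
  \<open>(-q)^(-|z|) T z\<close>. It is the composition of the usual bar involution
  \<open>T w \<mapsto> (T (w\<^sup>-\<^sup>1))\<^sup>-\<^sup>1\<close> with the linear automorphism \<open>T w \<mapsto> (-q)^|w| (T (w\<^sup>-\<^sup>1))\<^sup>-\<^sup>1\<close>, so it is a ring
  homomorphism. Working with \<open>\<psi>\<close> alone is convenient because it is diagonal in the basis \<open>T z\<close>:
  no inverses of basis elements enter its definition, and its multiplicativity (\<open>hecke_bar_T_mult\<close>)
  can be checked on products \<open>T s * T z\<close> with \<open>s\<close> a simple reflection.

  If \<open>\<psi> h = c h\<close>, comparing coefficients of \<open>T z\<close> shows that the coefficient \<open>h\<^sub>z\<close> satisfies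
  \<open>bar h\<^sub>z = c (-q)^|z| h\<^sub>z\<close> (\<open>bar_T_coeff\<close>). For \<open>h = T w * T z\<close> multiplicativity gives
  \<open>c = (-q)^(-|w|-|z|)\<close>; hence \<open>bar\<close> multiplies each diagonal matrix entry of left multiplication by
  \<open>T w\<close> by \<open>(-q)^(-|w|)\<close>, and so also the trace. For \<open>h = (-q)^|w| (T (w\<^sup>-\<^sup>1))\<^sup>-\<^sup>1\<close> one has
  \<open>c = (-q)^(-|w|)\<close>, which is the statement on the \<open>R\<close>-polynomials.

  The computation with \<open>T s * T z\<close> rests on the dichotomy \<open>|s z| = |z| \<plusminus> 1\<close>. This is where root
  systems enter: the Weyl group is generated by simple reflections, by induction on the height
  of a positive root (\<open>positive_refl_word\<close>), and \<open>|s z|\<close> and \<open>|z|\<close> have different parities because the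
  parity of the length is the parity of the number of inversions (\<open>parity_word\<close>).\<close>

section \<open>Reflections\<close>

lemma inner_refl_along: "refl_along \<alpha> x \<bullet> y = x \<bullet> refl_along \<alpha> y"
  by (simp add: refl_along_def inner_diff_left inner_diff_right inner_commute algebra_simps)

lemma refl_along_involution [simp]: "refl_along \<alpha> (refl_along \<alpha> x) = x"
  by (cases "\<alpha> = 0")
    (simp_all add: refl_along_def inner_diff_right algebra_simps flip: scaleR_add_left)

lemma refl_along_comp_self [simp]: "refl_along \<alpha> \<circ> refl_along \<alpha> = id"
  by (simp add: fun_eq_iff)

lemma refl_along_self: "\<alpha> \<noteq> 0 \<Longrightarrow> refl_along \<alpha> \<alpha> = - \<alpha>"
  by (simp add: refl_along_def scaleR_2)

lemma refl_along_uminus: "refl_along (- \<alpha>) = refl_along \<alpha>"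
  by (simp add: refl_along_def fun_eq_iff)

lemma refl_along_conj:
  fixes \<alpha> \<beta> :: "'a::euclidean_space"
  shows "refl_along \<alpha> \<circ> refl_along \<beta> \<circ> refl_along \<alpha> = refl_along (refl_along \<alpha> \<beta>)"
proof
  fix x
  have "refl_along \<alpha> (refl_along \<beta> (refl_along \<alpha> x)) =
      refl_along \<alpha> (refl_along \<alpha> x - (2 * (\<beta> \<bullet> refl_along \<alpha> x) / (\<beta> \<bullet> \<beta>)) *\<^sub>R \<beta>)"
    by (subst refl_along_def[of \<beta>]) (rule refl)
  also have "\<dots> = x - (2 * (\<beta> \<bullet> refl_along \<alpha> x) / (\<beta> \<bullet> \<beta>)) *\<^sub>R refl_along \<alpha> \<beta>"
    by (simp add: linear_diff[OF linear_refl_along] linear_cmul[OF linear_refl_along])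
  also have "\<dots> = refl_along (refl_along \<alpha> \<beta>) x"
    by (simp add: refl_along_def[of "refl_along \<alpha> \<beta>"] inner_refl_along)
  finally show "(refl_along \<alpha> \<circ> refl_along \<beta> \<circ> refl_along \<alpha>) x = refl_along (refl_along \<alpha> \<beta>) x"
    by simp
qed

definition refl_word :: "'a::euclidean_space list \<Rightarrow> 'a \<Rightarrow> 'a" where
  "refl_word as = foldr (\<circ>) (map refl_along as) id"

lemma refl_word_Nil [simp]: "refl_word [] = id"
  and refl_word_Cons [simp]: "refl_word (a # as) = refl_along a \<circ> refl_word as"
  by (simp_all add: refl_word_def)

lemma refl_word_append: "refl_word (as @ bs) = refl_word as \<circ> refl_word bs"
  by (induction as) (simp_all add: comp_assoc)

lemma refl_word_rev: "refl_word (rev as) (refl_word as x) = x"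
  by (induction as arbitrary: x) (simp_all add: refl_word_append)

lemma inv_refl_word: "inv (refl_word as) = refl_word (rev as)"
  by (rule inv_unique_comp)
    (use refl_word_rev[of as] refl_word_rev[of "rev as"] in \<open>simp_all add: fun_eq_iff\<close>)

section \<open>Simple reflections and lengths\<close>

locale simple_system =
  fixes \<Phi> \<Delta> :: "'a::euclidean_space set"
  assumes roots: "root_system \<Phi>" and simples: "simple_roots \<Phi> \<Delta>"
begin

abbreviation W where "W \<equiv> weyl_group \<Phi>"
abbreviation len where "len \<equiv> weyl_length \<Delta>"
abbreviation coef where "coef \<equiv> representation \<Delta>"

definition positive :: "'a \<Rightarrow> bool" where
  "positive v \<longleftrightarrow> (\<forall>\<alpha>\<in>\<Delta>. 0 \<le> coef v \<alpha>)"

lemma finite_roots: "finite \<Phi>" and simple_subset: "\<Delta> \<subseteq> \<Phi>" and indep: "independent \<Delta>"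
  using roots simples by (auto simp: root_system_def simple_roots_def)

lemma finite_simples: "finite \<Delta>"
  using finite_roots simple_subset finite_subset by blast

lemma root_nonzero: "\<beta> \<in> \<Phi> \<Longrightarrow> \<beta> \<noteq> 0"
  using roots by (auto simp: root_system_def)

lemma refl_root: "\<alpha> \<in> \<Phi> \<Longrightarrow> \<beta> \<in> \<Phi> \<Longrightarrow> refl_along \<alpha> \<beta> \<in> \<Phi>"
  using roots unfolding root_system_def by blast

lemma uminus_root: "\<beta> \<in> \<Phi> \<Longrightarrow> - \<beta> \<in> \<Phi>"
  using refl_root[of \<beta> \<beta>] refl_along_self[of \<beta>] root_nonzero by metis

lemma nat_combination_coef:
  assumes "v = (\<Sum>\<alpha>\<in>\<Delta>. real (c \<alpha>) *\<^sub>R \<alpha>)" and "\<alpha> \<in> \<Delta>"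
  shows "v \<in> span \<Delta>" and "coef v \<alpha> = real (c \<alpha>)"
proof -
  show "v \<in> span \<Delta>"
    unfolding assms(1) by (intro span_sum span_scale span_base)
  have "coef (\<Sum>\<alpha>\<in>\<Delta>. real (c \<alpha>) *\<^sub>R \<alpha>) \<alpha> = (\<Sum>\<gamma>\<in>\<Delta>. real (c \<gamma>) * coef \<gamma> \<alpha>)"
    by (simp add: real_vector.representation_sum[OF indep] span_scale span_base
        real_vector.representation_scale[OF indep])
  also have "\<dots> = (\<Sum>\<gamma>\<in>\<Delta>. if \<gamma> = \<alpha> then real (c \<gamma>) else 0)"
    by (intro sum.cong) (auto simp: real_vector.representation_basis[OF indep])
  finally show "coef v \<alpha> = real (c \<alpha>)"
    using assms finite_simples by simp
qed

lemma root_in_span: "\<beta> \<in> \<Phi> \<Longrightarrow> \<beta> \<in> span \<Delta>"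
proof -
  assume "\<beta> \<in> \<Phi>"
  then obtain c :: "'a \<Rightarrow> nat" where
    "\<beta> = (\<Sum>\<alpha>\<in>\<Delta>. real (c \<alpha>) *\<^sub>R \<alpha>) \<or> \<beta> = - (\<Sum>\<alpha>\<in>\<Delta>. real (c \<alpha>) *\<^sub>R \<alpha>)"
    using simples unfolding simple_roots_def by blast
  then show ?thesis
    by (elim disjE) (simp_all add: span_neg span_sum span_scale span_base)
qed

lemma coef_uminus: "\<beta> \<in> \<Phi> \<Longrightarrow> coef (- \<beta>) \<alpha> = - coef \<beta> \<alpha>"
  by (simp add: real_vector.representation_neg[OF indep] root_in_span)

lemma root_coef_cases:
  assumes "\<beta> \<in> \<Phi>"
  obtains c :: "'a \<Rightarrow> nat" where "\<And>\<alpha>. \<alpha> \<in> \<Delta> \<Longrightarrow> coef \<beta> \<alpha> = real (c \<alpha>)"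
  | c :: "'a \<Rightarrow> nat" where "\<And>\<alpha>. \<alpha> \<in> \<Delta> \<Longrightarrow> coef \<beta> \<alpha> = - real (c \<alpha>)"
proof -
  obtain c :: "'a \<Rightarrow> nat" where
    "\<beta> = (\<Sum>\<alpha>\<in>\<Delta>. real (c \<alpha>) *\<^sub>R \<alpha>) \<or> \<beta> = - (\<Sum>\<alpha>\<in>\<Delta>. real (c \<alpha>) *\<^sub>R \<alpha>)"
    using simples assms unfolding simple_roots_def by blast
  then consider "\<beta> = (\<Sum>\<alpha>\<in>\<Delta>. real (c \<alpha>) *\<^sub>R \<alpha>)" | "- \<beta> = (\<Sum>\<alpha>\<in>\<Delta>. real (c \<alpha>) *\<^sub>R \<alpha>)"
    by force
  then show ?thesis
  proof cases
    case 1
    then show ?thesis using nat_combination_coef(2) that(1) by blast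
  next
    case 2
    have "coef \<beta> \<alpha> = - real (c \<alpha>)" if "\<alpha> \<in> \<Delta>" for \<alpha>
      using nat_combination_coef(2)[OF 2 that] coef_uminus[OF assms, of \<alpha>] by simp
    then show ?thesis using that(2) by blast
  qed
qed

lemma root_expansion: "\<beta> \<in> \<Phi> \<Longrightarrow> (\<Sum>\<alpha>\<in>\<Delta>. coef \<beta> \<alpha> *\<^sub>R \<alpha>) = \<beta>"
  by (rule real_vector.sum_representation_eq[OF indep root_in_span finite_simples]) auto

lemma root_coef_nonzero:
  assumes "\<beta> \<in> \<Phi>"
  shows "\<exists>\<alpha>\<in>\<Delta>. coef \<beta> \<alpha> \<noteq> 0"
proof (rule ccontr)
  assume "\<not> ?thesis"
  then have "(\<Sum>\<alpha>\<in>\<Delta>. coef \<beta> \<alpha> *\<^sub>R \<alpha>) = 0" by simp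
  then show False using root_expansion root_nonzero assms by simp
qed

text \<open>The coordinates of a root in the simple roots never have mixed signs, so one positive
  coordinate decides the sign of the root.\<close>

lemma positive_if_coef_pos:
  assumes "\<beta> \<in> \<Phi>" "\<alpha> \<in> \<Delta>" "coef \<beta> \<alpha> > 0"
  shows "positive \<beta>"
  using assms(1)
proof (cases rule: root_coef_cases)
  case (2 c)
  then show ?thesis using assms(2,3) by simp
qed (simp add: positive_def)

lemma positive_uminus:
  assumes "\<beta> \<in> \<Phi>"
  shows "positive (- \<beta>) \<longleftrightarrow> \<not> positive \<beta>"
proof -
  obtain \<alpha> where \<alpha>: "\<alpha> \<in> \<Delta>" "coef \<beta> \<alpha> \<noteq> 0" using root_coef_nonzero[OF assms] ..
  then consider "coef \<beta> \<alpha> > 0" | "coef (- \<beta>) \<alpha> > 0"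
    using coef_uminus[OF assms, of \<alpha>] by linarith
  then show ?thesis
  proof cases
    case 1
    then have "positive \<beta>" using positive_if_coef_pos assms \<alpha> by blast
    moreover have "\<not> positive (- \<beta>)"
      using 1 \<alpha>(1) coef_uminus[OF assms, of \<alpha>] unfolding positive_def by force
    ultimately show ?thesis by blast
  next
    case 2
    then have "positive (- \<beta>)" using positive_if_coef_pos uminus_root assms \<alpha> by blast
    moreover have "\<not> positive \<beta>"
      using 2 \<alpha>(1) coef_uminus[OF assms, of \<alpha>] unfolding positive_def by force
    ultimately show ?thesis by blast
  qed
qed

lemma coef_simple: "\<alpha> \<in> \<Delta> \<Longrightarrow> coef \<alpha> \<gamma> = (if \<gamma> = \<alpha> then 1 else 0)"
  by (auto simp: real_vector.representation_basis[OF indep])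

lemma coef_refl_simple:
  assumes "\<alpha> \<in> \<Delta>" "\<beta> \<in> \<Phi>"
  shows "coef (refl_along \<alpha> \<beta>) \<gamma> =
    coef \<beta> \<gamma> - (if \<gamma> = \<alpha> then 2 * (\<alpha> \<bullet> \<beta>) / (\<alpha> \<bullet> \<alpha>) else 0)"
  unfolding refl_along_def using assms
  by (simp add: real_vector.representation_diff[OF indep] real_vector.representation_scale[OF indep]
      root_in_span span_scale span_base coef_simple)

text \<open>A positive root other than \<open>\<alpha>\<close> is not proportional to \<open>\<alpha>\<close>, the root system being reduced. It
  therefore has a positive coordinate at another simple root, which the reflection in \<open>\<alpha>\<close> leaves
  unchanged.\<close>

lemma positive_refl_simple:
  assumes \<alpha>: "\<alpha> \<in> \<Delta>" and \<beta>: "\<beta> \<in> \<Phi>" and pos: "positive \<beta>" and ne: "\<beta> \<noteq> \<alpha>"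
  shows "positive (refl_along \<alpha> \<beta>)"
proof -
  have "\<exists>\<gamma>\<in>\<Delta>. \<gamma> \<noteq> \<alpha> \<and> coef \<beta> \<gamma> \<noteq> 0"
  proof (rule ccontr)
    assume "\<not> ?thesis"
    then have "\<beta> = (\<Sum>\<gamma>\<in>\<Delta>. if \<gamma> = \<alpha> then coef \<beta> \<alpha> *\<^sub>R \<alpha> else 0)"
      by (subst root_expansion[OF \<beta>, symmetric]) (intro sum.cong, auto)
    then have eq: "\<beta> = coef \<beta> \<alpha> *\<^sub>R \<alpha>" using \<alpha> finite_simples by simp
    then have "coef \<beta> \<alpha> = 1 \<or> coef \<beta> \<alpha> = - 1"
      using roots \<alpha> \<beta> simple_subset unfolding root_system_def by (metis subsetD)
    then show False
      using eq ne pos \<alpha> unfolding positive_def by force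
  qed
  then obtain \<gamma> where \<gamma>: "\<gamma> \<in> \<Delta>" "\<gamma> \<noteq> \<alpha>" "coef \<beta> \<gamma> > 0"
    using pos unfolding positive_def by (metis less_eq_real_def)
  then have "coef (refl_along \<alpha> \<beta>) \<gamma> > 0" using coef_refl_simple \<alpha> \<beta> by simp
  then show ?thesis
    using positive_if_coef_pos \<gamma>(1) refl_root \<alpha> \<beta> simple_subset by blast
qed

lemma positive_refl_simple_iff:
  assumes \<alpha>: "\<alpha> \<in> \<Delta>" and \<beta>: "\<beta> \<in> \<Phi>" and ne: "\<beta> \<noteq> \<alpha>" "\<beta> \<noteq> - \<alpha>"
  shows "positive (refl_along \<alpha> \<beta>) \<longleftrightarrow> positive \<beta>"
proof -
  have \<alpha>0: "\<alpha> \<noteq> 0" using \<alpha> simple_subset root_nonzero by blast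
  have r: "refl_along \<alpha> \<beta> \<in> \<Phi>" using refl_root \<alpha> \<beta> simple_subset by blast
  have "refl_along \<alpha> \<beta> \<noteq> \<alpha>"
    using refl_along_self[OF \<alpha>0] refl_along_involution[of \<alpha> \<beta>] ne by metis
  then show ?thesis
    using positive_refl_simple[OF \<alpha> \<beta>] positive_refl_simple[OF \<alpha> r] ne by auto
qed

subsection \<open>Generation by simple reflections\<close>

text \<open>Otherwise expanding one factor of \<open>\<beta> \<bullet> \<beta>\<close> in simple roots would make it nonpositive.\<close>

lemma exists_descent_simple:
  assumes \<beta>: "\<beta> \<in> \<Phi>" and pos: "positive \<beta>"
  shows "\<exists>\<alpha>\<in>\<Delta>. \<alpha> \<bullet> \<beta> > 0"
proof (rule ccontr)
  assume neg: "\<not> ?thesis"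
  have "\<beta> \<bullet> \<beta> = (\<Sum>\<alpha>\<in>\<Delta>. coef \<beta> \<alpha> *\<^sub>R \<alpha>) \<bullet> \<beta>" by (simp add: root_expansion[OF \<beta>])
  also have "\<dots> = (\<Sum>\<alpha>\<in>\<Delta>. coef \<beta> \<alpha> * (\<alpha> \<bullet> \<beta>))" by (simp add: inner_sum_left)
  also have "\<dots> \<le> 0"
    using neg pos unfolding positive_def by (intro sum_nonpos mult_nonneg_nonpos) auto
  finally show False using root_nonzero[OF \<beta>] inner_gt_zero_iff[of \<beta>] by linarith
qed

definition height :: "'a \<Rightarrow> real" where
  "height v = (\<Sum>\<alpha>\<in>\<Delta>. coef v \<alpha>)"

lemma height_nat:
  assumes "\<beta> \<in> \<Phi>" "positive \<beta>"
  obtains n :: nat where "height \<beta> = real n"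
  using assms(1)
proof (cases rule: root_coef_cases)
  case (1 c)
  then have "height \<beta> = real (sum c \<Delta>)" by (simp add: height_def)
  then show ?thesis by (rule that)
next
  case (2 c)
  then have "coef \<beta> \<alpha> = 0" if "\<alpha> \<in> \<Delta>" for \<alpha>
    using assms(2) that unfolding positive_def by force
  then have "height \<beta> = real 0" by (simp add: height_def)
  then show ?thesis by (rule that)
qed

lemma height_refl_simple:
  assumes "\<alpha> \<in> \<Delta>" "\<beta> \<in> \<Phi>"
  shows "height (refl_along \<alpha> \<beta>) = height \<beta> - 2 * (\<alpha> \<bullet> \<beta>) / (\<alpha> \<bullet> \<alpha>)"
  using assms finite_simples by (simp add: height_def coef_refl_simple sum_subtractf)

text \<open>Induction on the height. If \<open>\<beta>\<close> is not simple, reflecting it in a simple root \<open>\<alpha>\<close> with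
  \<open>\<alpha> \<bullet> \<beta> > 0\<close> gives a positive root of smaller height, and the two reflections are conjugate by the
  reflection in \<open>\<alpha>\<close>.\<close>

lemma positive_refl_word:
  assumes "\<beta> \<in> \<Phi>" "positive \<beta>" "height \<beta> = real n"
  shows "\<exists>as. set as \<subseteq> \<Delta> \<and> refl_along \<beta> = refl_word as"
  using assms
proof (induction n arbitrary: \<beta> rule: less_induct)
  case (less n)
  obtain \<alpha> where \<alpha>: "\<alpha> \<in> \<Delta>" "\<alpha> \<bullet> \<beta> > 0"
    using exists_descent_simple less.prems by blast
  show ?case
  proof (cases "\<beta> = \<alpha>")
    case True
    then show ?thesis using \<alpha>(1) by (intro exI[of _ "[\<alpha>]"]) auto
  next
    case False
    define \<gamma> where "\<gamma> = refl_along \<alpha> \<beta>"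
    have \<gamma>: "\<gamma> \<in> \<Phi>" "positive \<gamma>"
      unfolding \<gamma>_def using refl_root positive_refl_simple False \<alpha> less.prems simple_subset by blast+
    then obtain m where m: "height \<gamma> = real m" using height_nat by blast
    have "\<alpha> \<noteq> 0" using \<alpha>(2) by auto
    then have "height \<gamma> < height \<beta>"
      unfolding \<gamma>_def using height_refl_simple[OF \<alpha>(1) less.prems(1)] \<alpha>(2) by simp
    then have "m < n" using m less.prems(3) by simp
    then obtain as where as: "set as \<subseteq> \<Delta>" "refl_along \<gamma> = refl_word as"
      using less.IH \<gamma> m by blast
    have "refl_along \<beta> = refl_along (refl_along \<alpha> \<gamma>)" by (simp add: \<gamma>_def)
    also have "\<dots> = refl_along \<alpha> \<circ> refl_along \<gamma> \<circ> refl_along \<alpha>"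
      by (rule refl_along_conj[symmetric])
    also have "\<dots> = refl_word (\<alpha> # as @ [\<alpha>])"
      by (simp add: refl_word_append as(2) comp_assoc)
    finally show ?thesis using as(1) \<alpha>(1) by (intro exI[of _ "\<alpha> # as @ [\<alpha>]"]) auto
  qed
qed

lemma root_refl_word:
  assumes "\<beta> \<in> \<Phi>"
  shows "\<exists>as. set as \<subseteq> \<Delta> \<and> refl_along \<beta> = refl_word as"
proof -
  obtain \<beta>' where "\<beta>' \<in> \<Phi>" "positive \<beta>'" "refl_along \<beta> = refl_along \<beta>'"
    using assms positive_uminus uminus_root refl_along_uminus by metis
  then show ?thesis using positive_refl_word height_nat by metis
qed

lemma refl_word_in_W: "set as \<subseteq> \<Phi> \<Longrightarrow> refl_word as \<in> W"
  by (induction as) (auto intro: weyl_group.intros)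

lemma simple_word_in_W: "set as \<subseteq> \<Delta> \<Longrightarrow> refl_word as \<in> W"
  using refl_word_in_W simple_subset by blast

lemma weyl_group_simple_word:
  assumes "w \<in> W"
  shows "\<exists>as. set as \<subseteq> \<Delta> \<and> w = refl_word as"
  using assms
proof induction
  case weyl_id
  show ?case by (intro exI[of _ "[]"]) simp
next
  case (weyl_refl \<beta> w)
  then obtain as bs where "set as \<subseteq> \<Delta>" "w = refl_word as" "set bs \<subseteq> \<Delta>" "refl_along \<beta> = refl_word bs"
    using root_refl_word by blast
  then show ?case by (intro exI[of _ "bs @ as"]) (simp add: refl_word_append)
qed

subsection \<open>Reduced words and the parity of the length\<close>

lemma reduced_word:
  assumes "w \<in> W"
  obtains as where "set as \<subseteq> \<Delta>" "length as = len w" "w = refl_word as"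
proof -
  have "\<exists>n as. set as \<subseteq> \<Delta> \<and> length as = n \<and> w = foldr (\<circ>) (map refl_along as) id"
    using weyl_group_simple_word[OF assms] unfolding refl_word_def by blast
  from LeastI_ex[OF this] show ?thesis
    using that unfolding weyl_length_def refl_word_def by blast
qed

lemma len_refl_word_le: "set as \<subseteq> \<Delta> \<Longrightarrow> len (refl_word as) \<le> length as"
  unfolding weyl_length_def refl_word_def by (rule Least_le) blast

definition inversions :: "('a \<Rightarrow> 'a) \<Rightarrow> 'a set" where
  "inversions w = {\<beta> \<in> \<Phi>. positive \<beta> \<and> \<not> positive (w \<beta>)}"

lemma finite_inversions: "finite (inversions w)"
  using finite_roots by (simp add: inversions_def)

lemma linear_weyl: "w \<in> W \<Longrightarrow> linear w"
proof (induction rule: weyl_group.induct)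
  case (weyl_refl \<alpha> w)
  then show ?case by (intro linear_compose linear_refl_along)
qed (rule linear_id)

lemma weyl_root: "w \<in> W \<Longrightarrow> \<beta> \<in> \<Phi> \<Longrightarrow> w \<beta> \<in> \<Phi>"
  by (induction rule: weyl_group.induct) (auto intro: refl_root)

lemma inv_weyl:
  assumes "w \<in> W"
  shows "inv w \<in> W" and "len (inv w) = len w" and "w (inv w x) = x" and "inv w (w x) = x"
proof -
  have le: "inv v \<in> W \<and> len (inv v) \<le> len v \<and> inv (inv v) = v \<and> (\<forall>x. v (inv v x) = x \<and> inv v (v x) = x)"
    if "v \<in> W" for v
  proof -
    obtain as where as: "set as \<subseteq> \<Delta>" "length as = len v" "v = refl_word as"
      using reduced_word[OF \<open>v \<in> W\<close>] .
    then show ?thesis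
      using len_refl_word_le[of "rev as"] simple_word_in_W[of "rev as"] refl_word_rev[of as]
        refl_word_rev[of "rev as"] by (simp add: inv_refl_word)
  qed
  show "inv w \<in> W" "w (inv w x) = x" "inv w (w x) = x"
    using le[OF assms] by blast+
  then show "len (inv w) = len w"
    using le[OF assms] le[of "inv w"] by (metis order_antisym)
qed

text \<open>Among all roots, the simple reflection in \<open>\<alpha>\<close> changes the sign of \<open>\<alpha>\<close> and \<open>-\<alpha>\<close> only, and exactly
  one positive root \<open>\<beta>\<^sub>0\<close> is sent by \<open>w\<close> to one of these two. The inversion sets therefore differ by
  \<open>\<beta>\<^sub>0\<close> alone.\<close>

lemma inversions_refl:
  assumes \<alpha>: "\<alpha> \<in> \<Delta>" and w: "w \<in> W"
  shows "even (card (inversions (refl_along \<alpha> \<circ> w))) \<longleftrightarrow> odd (card (inversions w))"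
proof -
  have \<alpha>\<Phi>: "\<alpha> \<in> \<Phi>" and \<alpha>0: "\<alpha> \<noteq> 0" using \<alpha> simple_subset root_nonzero by blast+
  define \<beta>\<^sub>0 where "\<beta>\<^sub>0 = (if positive (inv w \<alpha>) then inv w \<alpha> else - inv w \<alpha>)"
  have iw: "inv w \<alpha> \<in> \<Phi>" using weyl_root inv_weyl(1) w \<alpha>\<Phi> by blast
  have \<beta>\<^sub>0: "\<beta>\<^sub>0 \<in> \<Phi>" "positive \<beta>\<^sub>0"
    using iw uminus_root positive_uminus by (auto simp: \<beta>\<^sub>0_def)
  have w\<beta>\<^sub>0: "w \<beta>\<^sub>0 = \<alpha> \<or> w \<beta>\<^sub>0 = - \<alpha>"
    using inv_weyl(3)[OF w] linear_neg[OF linear_weyl[OF w]] by (simp add: \<beta>\<^sub>0_def)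
  have flip: "positive (refl_along \<alpha> (w \<beta>\<^sub>0)) \<longleftrightarrow> \<not> positive (w \<beta>\<^sub>0)"
    using w\<beta>\<^sub>0 positive_uminus[OF \<alpha>\<Phi>] linear_neg[OF linear_refl_along, of \<alpha> \<alpha>]
      refl_along_self[OF \<alpha>0] by auto
  have keep: "positive (refl_along \<alpha> (w \<beta>)) \<longleftrightarrow> positive (w \<beta>)"
    if "\<beta> \<in> \<Phi>" "positive \<beta>" "\<beta> \<noteq> \<beta>\<^sub>0" for \<beta>
  proof (rule positive_refl_simple_iff[OF \<alpha> weyl_root[OF w that(1)]])
    have iwneg: "inv w (- \<alpha>) = - inv w \<alpha>"
      using linear_neg[OF linear_weyl[OF inv_weyl(1)[OF w]]] .
    show "w \<beta> \<noteq> \<alpha>"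
    proof
      assume "w \<beta> = \<alpha>"
      then have "\<beta> = inv w \<alpha>" using inv_weyl(4)[OF w] by metis
      then show False using that by (simp add: \<beta>\<^sub>0_def)
    qed
    show "w \<beta> \<noteq> - \<alpha>"
    proof
      assume "w \<beta> = - \<alpha>"
      then have "\<beta> = - inv w \<alpha>" using inv_weyl(4)[OF w] iwneg by metis
      then show False using that positive_uminus[OF iw] by (auto simp: \<beta>\<^sub>0_def)
    qed
  qed
  show ?thesis
  proof (cases "positive (w \<beta>\<^sub>0)")
    case True
    then have "inversions (refl_along \<alpha> \<circ> w) = insert \<beta>\<^sub>0 (inversions w)" "\<beta>\<^sub>0 \<notin> inversions w"
      using flip keep \<beta>\<^sub>0 by (auto simp: inversions_def)
    then show ?thesis using finite_inversions by simp
  next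
    case False
    then have "inversions w = insert \<beta>\<^sub>0 (inversions (refl_along \<alpha> \<circ> w))"
      "\<beta>\<^sub>0 \<notin> inversions (refl_along \<alpha> \<circ> w)"
      using flip keep \<beta>\<^sub>0 by (auto simp: inversions_def)
    then show ?thesis using finite_inversions by simp
  qed
qed

lemma parity_word: "set as \<subseteq> \<Delta> \<Longrightarrow> even (card (inversions (refl_word as))) \<longleftrightarrow> even (length as)"
proof (induction as)
  case Nil
  then show ?case by (simp add: inversions_def)
next
  case (Cons a as)
  then show ?case using inversions_refl[of a "refl_word as"] simple_word_in_W[of as] by (simp add: comp_def)
qed

lemma parity_len: "w \<in> W \<Longrightarrow> even (card (inversions w)) \<longleftrightarrow> even (len w)"
  using reduced_word[of w] parity_word by metis

lemma simple_refl_in_W: "\<alpha> \<in> \<Delta> \<Longrightarrow> refl_along \<alpha> \<in> W"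
  using simple_word_in_W[of "[\<alpha>]"] by simp

lemma refl_comp_in_W: "\<alpha> \<in> \<Delta> \<Longrightarrow> w \<in> W \<Longrightarrow> refl_along \<alpha> \<circ> w \<in> W"
  using simple_subset by (blast intro: weyl_group.intros)

lemma len_refl_le:
  assumes "\<alpha> \<in> \<Delta>" "w \<in> W"
  shows "len (refl_along \<alpha> \<circ> w) \<le> Suc (len w)"
proof -
  obtain as where "set as \<subseteq> \<Delta>" "length as = len w" "w = refl_word as"
    using reduced_word[OF assms(2)] .
  then show ?thesis using len_refl_word_le[of "\<alpha> # as"] assms(1) by simp
qed

text \<open>The two lengths differ by at most one, and by parity they are not equal.\<close>

lemma len_refl_cases:
  assumes "\<alpha> \<in> \<Delta>" "w \<in> W"
  obtains "len (refl_along \<alpha> \<circ> w) = Suc (len w)" | "len w = Suc (len (refl_along \<alpha> \<circ> w))"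
proof -
  have W': "refl_along \<alpha> \<circ> w \<in> W" using refl_comp_in_W assms .
  have "len w \<le> Suc (len (refl_along \<alpha> \<circ> w))"
    using len_refl_le[OF assms(1) W'] by (simp flip: comp_assoc)
  moreover have "len w \<noteq> len (refl_along \<alpha> \<circ> w)"
    using inversions_refl[OF assms] parity_len assms(2) W' by metis
  ultimately show ?thesis using len_refl_le[OF assms] that by linarith
qed

lemma len_id [simp]: "len id = 0"
  using len_refl_word_le[of "[]"] by simp

lemma len_refl: "\<alpha> \<in> \<Delta> \<Longrightarrow> len (refl_along \<alpha>) = 1"
  by (rule len_refl_cases[of \<alpha> id]) (simp_all add: weyl_group.weyl_id)

text \<open>Induction along a reduced word, built from right to left.\<close>

lemma weyl_length_induct [consumes 1, case_names id refl]:
  assumes "w \<in> W" and "P id"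
    and "\<And>\<alpha> w. \<lbrakk>\<alpha> \<in> \<Delta>; w \<in> W; len (refl_along \<alpha> \<circ> w) = Suc (len w); P w\<rbrakk>
      \<Longrightarrow> P (refl_along \<alpha> \<circ> w)"
  shows "P w"
  using assms(1)
proof (induction "len w" arbitrary: w)
  case 0
  then show ?case using reduced_word[of w] assms(2) by (metis length_0_conv refl_word_Nil)
next
  case (Suc n)
  then obtain as where as: "set as \<subseteq> \<Delta>" "length as = Suc n" "w = refl_word as"
    using reduced_word[of w] by metis
  then obtain \<alpha> bs where bs: "as = \<alpha> # bs" by (metis length_Suc_conv)
  let ?v = "refl_word bs"
  have v: "\<alpha> \<in> \<Delta>" "?v \<in> W" "len ?v \<le> n" "w = refl_along \<alpha> \<circ> ?v"
    using as bs simple_word_in_W len_refl_word_le[of bs] by auto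
  then have "len ?v = n" using len_refl_le[of \<alpha> ?v] Suc.hyps(2) by simp
  then show ?case using assms(3)[of \<alpha> ?v] Suc v by simp
qed

end

section \<open>The Hecke algebra\<close>

lemma bar_neg: "bar (- x) = - bar x"
  using bar_add[of x "- x"] by (simp add: eq_neg_iff_add_eq_0 add.commute)

lemma bar_power: "bar (x ^ n) = bar x ^ n"
  by (induction n) (simp_all add: bar_mult)

context iwahori_hecke_algebra
begin

subsection \<open>The standard basis\<close>

sublocale simple_system \<Phi> \<Delta>
  by unfold_locales (rule roots simples)+

abbreviation T_coeff :: "'h \<Rightarrow> ('a \<Rightarrow> 'a) \<Rightarrow> ratfun" where
  "T_coeff h z \<equiv> representation (T ` W) h (T z)"

lemma in_T_span [simp]: "h \<in> span (T ` W)"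
  using T_span by simp

lemma finite_W: "finite W"
  by (rule finite_weyl_group[OF roots])

lemma T_coeff_T: "w \<in> W \<Longrightarrow> z \<in> W \<Longrightarrow> T_coeff (T w) z = (if z = w then 1 else 0)"
  by (auto simp: representation_basis[OF T_indep] inj_on_eq_iff[OF T_inj])

lemma T_expansion: "(\<Sum>z\<in>W. smul (T_coeff h z) (T z)) = h"
  using sum_representation_eq[OF T_indep, of h "T ` W"] finite_W by (simp add: sum.reindex[OF T_inj])

lemma T_coeff_sum:
  assumes "z \<in> W"
  shows "T_coeff (\<Sum>y\<in>W. smul (c y) (T y)) z = c z"
proof -
  have "T_coeff (\<Sum>y\<in>W. smul (c y) (T y)) z = (\<Sum>y\<in>W. c y * T_coeff (T y) z)"
    by (simp add: representation_sum[OF T_indep] representation_scale[OF T_indep])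
  also have "\<dots> = (\<Sum>y\<in>W. if y = z then c z else 0)"
    using assms by (intro sum.cong) (auto simp: T_coeff_T)
  finally show ?thesis using assms finite_W by simp
qed

text \<open>By the multiplication rule for the pair \<open>(id, w)\<close>, \<open>T id\<close> is a left identity on the basis, hence on
  all of the algebra; applied to 1 this gives the claim.\<close>

lemma T_id: "T id = 1"
proof -
  have "T id * T w = T w" if "w \<in> W" for w
    using T_mult[OF weyl_group.weyl_id that] by simp
  then have "T id * (\<Sum>z\<in>W. smul (T_coeff 1 z) (T z)) = (\<Sum>z\<in>W. smul (T_coeff 1 z) (T z))"
    by (simp add: sum_distrib_left flip: smul_mult_right)
  then show ?thesis by (simp add: T_expansion)
qed

lemma T_refl_up:
  assumes "\<alpha> \<in> \<Delta>" "w \<in> W" "len (refl_along \<alpha> \<circ> w) = Suc (len w)"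
  shows "T (refl_along \<alpha>) * T w = T (refl_along \<alpha> \<circ> w)"
  using assms T_mult[of "refl_along \<alpha>" w] simple_refl_in_W len_refl by simp

lemma T_refl_square:
  assumes "\<alpha> \<in> \<Delta>"
  shows "T (refl_along \<alpha>) * T (refl_along \<alpha>) = smul (qq - 1) (T (refl_along \<alpha>)) + smul qq 1"
proof -
  let ?t = "T (refl_along \<alpha>)"
  have "0 = (?t - smul qq 1) * (?t + 1)"
    by (rule T_quadratic[symmetric]) (use simple_refl_in_W len_refl assms in auto)
  also have "\<dots> = ?t * ?t - (smul (qq - 1) ?t + smul qq 1)"
    by (simp add: left_diff_distrib distrib_left scale_left_diff_distrib flip: smul_mult_left)
  finally show ?thesis by simp
qed

lemma T_refl_down:
  assumes "\<alpha> \<in> \<Delta>" "w \<in> W" "len w = Suc (len (refl_along \<alpha> \<circ> w))"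
  shows "T (refl_along \<alpha>) * T w = smul (qq - 1) (T w) + smul qq (T (refl_along \<alpha> \<circ> w))"
proof -
  let ?t = "T (refl_along \<alpha>)" and ?v = "refl_along \<alpha> \<circ> w"
  have Tw: "T w = ?t * T ?v"
    using T_refl_up[OF assms(1) refl_comp_in_W[OF assms(1,2)]] assms(3) by (simp flip: comp_assoc)
  have "?t * T w = (?t * ?t) * T ?v" by (simp add: Tw mult.assoc)
  also have "\<dots> = smul (qq - 1) (T w) + smul qq (T ?v)"
    by (simp add: T_refl_square[OF assms(1)] Tw distrib_right flip: smul_mult_left)
  finally show ?thesis .
qed

subsection \<open>The semilinear map and its multiplicativity\<close>

definition hecke_bar :: "'h \<Rightarrow> 'h" where
  "hecke_bar h = (\<Sum>z\<in>W. smul (bar (T_coeff h z) * inverse (- qq) ^ len z) (T z))"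

lemma T_coeff_hecke_bar: "z \<in> W \<Longrightarrow> T_coeff (hecke_bar h) z = bar (T_coeff h z) * inverse (- qq) ^ len z"
  unfolding hecke_bar_def by (rule T_coeff_sum)

lemma hecke_bar_add: "hecke_bar (g + h) = hecke_bar g + hecke_bar h"
  by (simp add: hecke_bar_def representation_add[OF T_indep] bar_add distrib_right scale_left_distrib
      sum.distrib)

lemma hecke_bar_smul: "hecke_bar (smul c h) = smul (bar c) (hecke_bar h)"
  by (simp add: hecke_bar_def representation_scale[OF T_indep] bar_mult scale_sum_right mult.assoc)

lemma hecke_bar_sum: "hecke_bar (\<Sum>x\<in>A. f x) = (\<Sum>x\<in>A. hecke_bar (f x))"
proof -
  have "hecke_bar 0 = 0" using hecke_bar_add[of 0 0] by simp
  then show ?thesis by (induction A rule: infinite_finite_induct) (simp_all add: hecke_bar_add)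
qed

lemma hecke_bar_T:
  assumes "w \<in> W"
  shows "hecke_bar (T w) = smul (inverse (- qq) ^ len w) (T w)"
proof -
  have "hecke_bar (T w) = (\<Sum>z\<in>W. if z = w then smul (inverse (- qq) ^ len w) (T w) else 0)"
    unfolding hecke_bar_def using assms by (intro sum.cong) (auto simp: T_coeff_T)
  then show ?thesis using assms finite_W by simp
qed

lemma hecke_bar_one: "hecke_bar 1 = 1"
  using hecke_bar_T[OF weyl_group.weyl_id] by (simp add: T_id)

text \<open>If \<open>|s w| = |w| + 1\<close> both sides are a power of \<open>-q\<close> times \<open>T (s w)\<close>. If \<open>|s w| = |w| - 1\<close>, then
  \<open>T s * T w = (q - 1) T w + q T (s w)\<close>, and the two coefficients satisfy
  \<open>bar (q - 1) = (-q)\<^sup>-\<^sup>1 (q - 1)\<close> and \<open>bar q = (-q)\<^sup>-\<^sup>2 q\<close>; the additional power of \<open>-q\<close> in the second one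
  makes up for the drop in length.\<close>

lemma hecke_bar_T_refl_mult_T:
  assumes "\<alpha> \<in> \<Delta>" "w \<in> W"
  shows "hecke_bar (T (refl_along \<alpha>) * T w) = smul (inverse (- qq)) (T (refl_along \<alpha>) * hecke_bar (T w))"
  using assms
proof (cases rule: len_refl_cases)
  case 1
  then show ?thesis
    using assms by (simp add: T_refl_up hecke_bar_T refl_comp_in_W flip: smul_mult_right)
next
  case 2
  let ?v = "refl_along \<alpha> \<circ> w" and ?u = "inverse (- qq)"
  have c1: "bar (qq - 1) * ?u ^ len w = ?u ^ len w * ?u * (qq - 1)"
  proof -
    have "bar (qq - 1) = ?u * (qq - 1)"
      using bar_add[of qq "- 1"] by (simp add: bar_qq bar_neg right_diff_distrib)
    then show ?thesis by (simp only: mult_ac)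
  qed
  have c2: "bar qq * ?u ^ len ?v = ?u ^ len w * ?u * qq"
    by (simp add: 2 bar_qq)
  have "hecke_bar (T (refl_along \<alpha>) * T w) =
      smul (bar (qq - 1) * ?u ^ len w) (T w) + smul (bar qq * ?u ^ len ?v) (T ?v)"
    using assms 2
    by (simp add: T_refl_down hecke_bar_add hecke_bar_smul hecke_bar_T refl_comp_in_W)
  also have "\<dots> = smul (?u ^ len w * ?u) (T (refl_along \<alpha>) * T w)"
    unfolding c1 c2 by (simp add: T_refl_down[OF assms 2] scale_right_distrib)
  also have "\<dots> = smul ?u (T (refl_along \<alpha>) * hecke_bar (T w))"
    by (simp add: hecke_bar_T[OF assms(2)] mult.commute flip: smul_mult_right)
  finally show ?thesis .
qed

lemma hecke_bar_T_refl_mult: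
  assumes "\<alpha> \<in> \<Delta>"
  shows "hecke_bar (T (refl_along \<alpha>) * h) = smul (inverse (- qq)) (T (refl_along \<alpha>) * hecke_bar h)"
proof -
  let ?t = "T (refl_along \<alpha>)" and ?c = "T_coeff h"
  have "hecke_bar (?t * h) = hecke_bar (\<Sum>z\<in>W. smul (?c z) (?t * T z))"
    by (subst T_expansion[of h, symmetric]) (simp add: sum_distrib_left smul_mult_right)
  also have "\<dots> = (\<Sum>z\<in>W. smul (bar (?c z)) (smul (inverse (- qq)) (?t * hecke_bar (T z))))"
    using hecke_bar_T_refl_mult_T[OF assms] by (simp only: hecke_bar_sum hecke_bar_smul cong: sum.cong)
  also have "\<dots> = smul (inverse (- qq)) (?t * hecke_bar (\<Sum>z\<in>W. smul (?c z) (T z)))"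
    by (simp only: hecke_bar_sum hecke_bar_smul sum_distrib_left scale_sum_right scale_left_commute
        flip: smul_mult_right)
  finally show ?thesis by (simp only: T_expansion)
qed

text \<open>Left multiplication by \<open>T w\<close> is a composition of left multiplications by the \<open>T s\<close> along a
  reduced word of \<open>w\<close>.\<close>

lemma hecke_bar_T_mult:
  assumes "w \<in> W"
  shows "hecke_bar (T w * h) = smul (inverse (- qq) ^ len w) (T w * hecke_bar h)"
  using assms
proof (induction arbitrary: h rule: weyl_length_induct)
  case id
  show ?case by (simp add: T_id flip: id_def)
next
  case (refl \<alpha> w)
  let ?u = "inverse (- qq)" and ?t = "T (refl_along \<alpha>)"
  note up = T_refl_up[OF refl(1-3), symmetric]
  have "hecke_bar (T (refl_along \<alpha> \<circ> w) * h) = hecke_bar (?t * (T w * h))"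
    by (simp only: up mult.assoc)
  also have "\<dots> = smul ?u (?t * smul (?u ^ len w) (T w * hecke_bar h))"
    by (simp only: hecke_bar_T_refl_mult[OF refl(1)] refl.IH)
  also have "\<dots> = smul (?u ^ len (refl_along \<alpha> \<circ> w)) (T (refl_along \<alpha> \<circ> w) * hecke_bar h)"
    by (simp only: up refl(3) power_Suc mult.assoc scale_scale smul_mult_right[symmetric])
  finally show ?case .
qed

text \<open>The coefficients of \<open>hecke_bar h\<close> are the conjugated coefficients of \<open>h\<close> up to known powers
  of \<open>-q\<close>. For an eigenvector this is a functional equation for each coefficient.\<close>

lemma bar_T_coeff:
  assumes "hecke_bar h = smul c h" "z \<in> W"
  shows "bar (T_coeff h z) = c * (- qq) ^ len z * T_coeff h z"
proof -
  have inv: "inverse (- qq) ^ len z * (- qq) ^ len z = 1"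
    by (simp flip: power_mult_distrib)
  have "bar (T_coeff h z) = bar (T_coeff h z) * inverse (- qq) ^ len z * (- qq) ^ len z"
    by (simp only: mult.assoc inv mult_1_right)
  also have "bar (T_coeff h z) * inverse (- qq) ^ len z = c * T_coeff h z"
    using T_coeff_hecke_bar[OF assms(2), of h] assms(1) by (simp add: representation_scale[OF T_indep])
  finally show ?thesis by (simp only: mult_ac)
qed

lemma T_invertible:
  assumes "w \<in> W"
  shows "\<exists>y. T w * y = 1 \<and> y * T w = 1"
  using assms
proof (induction rule: weyl_length_induct)
  case id
  show ?case by (simp add: T_id flip: id_def)
next
  case (refl \<alpha> w)
  let ?t = "T (refl_along \<alpha>)"
  \<comment> \<open>The quadratic relation reads \<open>t * (t - (q - 1)) = q\<close>.\<close>
  let ?t' = "smul (inverse qq) (?t - smul (qq - 1) 1)"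
  have "?t * ?t' = 1" "?t' * ?t = 1"
    by (simp_all add: T_refl_square[OF refl(1)] left_diff_distrib right_diff_distrib
        flip: smul_mult_left smul_mult_right)
  moreover obtain y where "T w * y = 1" "y * T w = 1" using refl.IH by blast
  ultimately have "(?t * T w) * (y * ?t') = 1" "(y * ?t') * (?t * T w) = 1"
    by (metis mult.assoc mult.left_neutral)+
  then show ?case using T_refl_up[OF refl(1-3)] by metis
qed

lemma ring_inv_T:
  assumes "w \<in> W"
  shows "T w * ring_inv (T w) = 1" and "ring_inv (T w) * T w = 1"
proof -
  obtain y where y: "T w * y = 1" "y * T w = 1" using T_invertible[OF assms] by blast
  have "ring_inv (T w) = y"
    unfolding ring_inv_def by (rule the_equality) (use y in \<open>metis mult.assoc mult.left_neutral mult.right_neutral\<close>)+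
  then show "T w * ring_inv (T w) = 1" "ring_inv (T w) * T w = 1" using y by simp_all
qed

text \<open>Applying \<open>hecke_bar\<close> to \<open>T w * (T w)\<^sup>-\<^sup>1 = 1\<close> shows that the image of \<open>(T w)\<^sup>-\<^sup>1\<close> is inverse to the
  image \<open>(-q)^(-|w|) T w\<close> of \<open>T w\<close>.\<close>

lemma hecke_bar_ring_inv_T:
  assumes "w \<in> W"
  shows "hecke_bar (ring_inv (T w)) = smul ((- qq) ^ len w) (ring_inv (T w))"
proof -
  let ?y = "ring_inv (T w)" and ?k = "(- qq) ^ len w" and ?u = "inverse (- qq) ^ len w"
  have ku: "?k * ?u = 1" by (simp flip: power_mult_distrib)
  have "smul ?u (T w * hecke_bar ?y) = 1"
    using hecke_bar_T_mult[OF assms, of ?y] by (simp only: ring_inv_T[OF assms] hecke_bar_one)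
  then have "smul ?k 1 = smul (?k * ?u) (T w * hecke_bar ?y)" by (metis scale_scale)
  then have "T w * hecke_bar ?y = smul ?k 1" by (simp only: ku scale_one)
  then have "?y * (T w * hecke_bar ?y) = smul ?k ?y"
    by (metis smul_mult_right mult.right_neutral)
  then show ?thesis by (simp add: ring_inv_T[OF assms] flip: mult.assoc)
qed

subsection \<open>Functional equations for traces and R-polynomials\<close>

text \<open>Each summand \<open>T_coeff (T w * T z) z\<close> of the trace satisfies the functional equation separately:
  \<open>T w * T z\<close> is an eigenvector with eigenvalue \<open>(-q)^(-|w|-|z|)\<close>, and the factor \<open>(-q)^|z|\<close> from reading off
  the coefficient of \<open>T z\<close> cancels the dependence on \<open>z\<close>.\<close>

lemma bar_hecke_tau:
  assumes "w \<in> W"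
  shows "bar (hecke_tau smul \<Phi> T w) = (- qq) powi (- int (len w)) * hecke_tau smul \<Phi> T w"
proof -
  have tau: "hecke_tau smul \<Phi> T w = (\<Sum>z\<in>W. T_coeff (T w * T z) z)"
    by (simp add: hecke_tau_def lin_trace_def sum.reindex[OF T_inj])
  have bar_sum: "bar (\<Sum>z\<in>A. f z) = (\<Sum>z\<in>A. bar (f z))" for f :: "('a \<Rightarrow> 'a) \<Rightarrow> ratfun" and A
    by (induction A rule: infinite_finite_induct) (simp_all add: bar_add)
  have "bar (T_coeff (T w * T z) z) = (- qq) powi (- int (len w)) * T_coeff (T w * T z) z"
    if "z \<in> W" for z
  proof -
    have "hecke_bar (T w * T z) = smul (inverse (- qq) ^ len w * inverse (- qq) ^ len z) (T w * T z)"
      using hecke_bar_T_mult[OF assms] that by (simp add: hecke_bar_T flip: smul_mult_right)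
    from bar_T_coeff[OF this that]
    have "bar (T_coeff (T w * T z) z) =
        inverse (- qq) ^ len w * (inverse (- qq) ^ len z * (- qq) ^ len z) * T_coeff (T w * T z) z"
      by (simp only: mult.assoc)
    also have "inverse (- qq) ^ len z * (- qq) ^ len z = 1"
      by (simp flip: power_mult_distrib)
    finally show ?thesis
      by (simp only: power_int_minus power_int_of_nat power_inverse mult_1_right)
  qed
  then show ?thesis unfolding tau by (simp add: bar_sum sum_distrib_left)
qed

text \<open>As \<open>|w\<^sup>-\<^sup>1| = |w|\<close>, the factor by which \<open>hecke_bar\<close> multiplies \<open>(T (w\<^sup>-\<^sup>1))\<^sup>-\<^sup>1\<close> is \<open>(-q)^|w|\<close>, while the
  scalar in front of it is inverted. The vector defining the \<open>R\<close>-polynomials is thus an eigenvector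
  with eigenvalue \<open>(-q)^(-|w|)\<close>.\<close>

lemma bar_hecke_R:
  assumes w: "w \<in> W" and z: "z \<in> W"
  shows "bar (hecke_R smul \<Phi> \<Delta> T z w) =
    (- qq) powi (- int (len w) + int (len z)) * hecke_R smul \<Phi> \<Delta> T z w"
proof -
  let ?h = "smul ((- qq) ^ len w) (ring_inv (T (inv w)))" and ?u = "inverse (- qq) ^ len w"
  have "hecke_bar ?h = smul (?u * (- qq) ^ len w) (ring_inv (T (inv w)))"
    using inv_weyl[OF w]
    by (simp add: hecke_bar_smul hecke_bar_ring_inv_T bar_power bar_neg bar_qq)
  then have "bar (T_coeff ?h z) = ?u * (- qq) ^ len z * T_coeff ?h z"
    by (intro bar_T_coeff z) simp
  moreover have "(- qq) powi (- int (len w) + int (len z)) = ?u * (- qq) ^ len z"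
    by (subst power_int_add) (simp, simp only: power_int_minus power_int_of_nat power_inverse)
  ultimately show ?thesis
    unfolding hecke_R_def by (simp add: bar_mult bar_power bar_neg)
qed

end

theorem corollary5p3:
  fixes smul :: "ratfun \<Rightarrow> 'h::ring_1 \<Rightarrow> 'h"
    and \<Phi> \<Delta> :: "'a::euclidean_space set"
    and T :: "('a \<Rightarrow> 'a) \<Rightarrow> 'h"
  assumes "iwahori_hecke_algebra smul \<Phi> \<Delta> T"
  shows "(\<forall>w \<in> weyl_group \<Phi>.
            bar (hecke_tau smul \<Phi> T w) =
              (- qq) powi (- int (weyl_length \<Delta> w)) * hecke_tau smul \<Phi> T w) \<and>
         (\<forall>w \<in> weyl_group \<Phi>. \<forall>z \<in> weyl_group \<Phi>.
            bar (hecke_R smul \<Phi> \<Delta> T z w) =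
              (- qq) powi (- int (weyl_length \<Delta> w) + int (weyl_length \<Delta> z)) *
              hecke_R smul \<Phi> \<Delta> T z w)"
proof -
  interpret iwahori_hecke_algebra smul \<Phi> \<Delta> T by fact
  show ?thesis using bar_hecke_tau bar_hecke_R by blast
qed

end
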